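(* Let $A$ be a complex unital $C^\star$-algebra with unit $\mathbf 1$. Let $\phi:A\to\mathbb C$ be a function (not assumed linear or multiplicative) such that (P1) $\phi(x)\phi(y)\in\sigma(xy)$ for all $x,y\in A$; (P2) $\phi(\mathbf 1)=1$; (P3) $\phi$ is continuous on $A$. Then the formula $$\psi_\phi(x):=\phi\left(\operatorname{Re}(x)\right)+i\,\phi\left(\operatorname{Im}(x)\right)\qquad(x\in A)$$ defines a character $\psi_\phi$ on $A$.
   Context: For $x\in A$, $\sigma(x)$ denotes the spectrum of $x$ in $A$, $\operatorname{Re}(x):=(x+x^\star)/2$ and $\operatorname{Im}(x):=(x-x^\star)/(2i)$. A character of $A$ is a linear functional $\chi:A\to\mathbb C$ which is multiplicative, i.e. $\chi(xy)=\chi(x)\chi(y)$ for all $x,y\in A$. *)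

theory Defs
  imports Complex_Main
begin

text \<open>
  The library has no complex normed spaces, so the complex structure is added on top of
  \<^class>\<open>real_normed_algebra_1\<close>, compatibly with the real scaling (as in the real case, this class
  includes \<open>0 \<noteq> 1\<close> and \<open>norm 1 = 1\<close>; the latter is automatic in a nonzero unital C*-algebra).
\<close>

class complex_banach_algebra_1 = real_normed_algebra_1 + banach +
  fixes scaleC :: "complex \<Rightarrow> 'a \<Rightarrow> 'a"  (infixr "*\<^sub>C" 75)
  assumes scaleC_of_real: "complex_of_real r *\<^sub>C x = r *\<^sub>R x"
    and scaleC_add_right: "c *\<^sub>C (x + y) = c *\<^sub>C x + c *\<^sub>C y"
    and scaleC_add_left: "(c + d) *\<^sub>C x = c *\<^sub>C x + d *\<^sub>C x"
    and scaleC_scaleC: "c *\<^sub>C d *\<^sub>C x = (c * d) *\<^sub>C x"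
    and scaleC_one: "1 *\<^sub>C x = x"
    and mult_scaleC_left: "(c *\<^sub>C x) * y = c *\<^sub>C (x * y)"
    and mult_scaleC_right: "x * (c *\<^sub>C y) = c *\<^sub>C (x * y)"
    and norm_scaleC: "norm (c *\<^sub>C x) = cmod c * norm x"

lemma vector_space_scaleC: "vector_space (scaleC :: complex \<Rightarrow> 'a \<Rightarrow> 'a::complex_banach_algebra_1)"
  by unfold_locales
    (simp_all add: scaleC_add_right scaleC_add_left scaleC_scaleC scaleC_one)

class cstar_algebra_1 = complex_banach_algebra_1 +
  fixes star :: "'a \<Rightarrow> 'a"
  assumes star_star: "star (star x) = x"
    and star_add: "star (x + y) = star x + star y"
    and star_scaleC: "star (c *\<^sub>C x) = cnj c *\<^sub>C star x"
    and star_mult: "star (x * y) = star y * star x"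
    and cstar_identity: "norm (star x * x) = (norm x)\<^sup>2"

instantiation complex :: cstar_algebra_1
begin

definition scaleC_complex :: "complex \<Rightarrow> complex \<Rightarrow> complex"
  where "scaleC_complex c x = c * x"

definition star_complex :: "complex \<Rightarrow> complex"
  where "star_complex = cnj"

instance
  by standard
    (simp_all add: scaleC_complex_def star_complex_def scaleR_conv_of_real
      algebra_simps norm_mult power2_eq_square)

end

text \<open>Invertibility is two-sided, since the algebra need not be commutative.\<close>

definition spectrum :: "'a::complex_banach_algebra_1 \<Rightarrow> complex set"
  where "spectrum x =
    {c. \<not> (\<exists>y. y * (c *\<^sub>C 1 - x) = 1 \<and> (c *\<^sub>C 1 - x) * y = 1)}"

definition re_part :: "'a::cstar_algebra_1 \<Rightarrow> 'a"
  where "re_part x = (1 / 2) *\<^sub>C (x + star x)"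

definition im_part :: "'a::cstar_algebra_1 \<Rightarrow> 'a"
  where "im_part x = (1 / (2 * \<i>)) *\<^sub>C (x - star x)"

text \<open>The zero functional is not excluded.\<close>

definition is_character :: "('a::complex_banach_algebra_1 \<Rightarrow> complex) \<Rightarrow> bool"
  where "is_character \<chi> \<longleftrightarrow>
    Vector_Spaces.linear scaleC times \<chi> \<and> (\<forall>x y. \<chi> (x * y) = \<chi> x * \<chi> y)"

definition psi :: "('a::cstar_algebra_1 \<Rightarrow> complex) \<Rightarrow> 'a \<Rightarrow> complex"
  where "psi \<phi> x = \<phi> (re_part x) + \<i> * \<phi> (im_part x)"

end

theory Submission
  imports Defs
begin

text \<open>
  For invertible \<open>x\<close> the hypothesis gives \<open>\<phi> w = \<phi> x * c\<close> with \<open>c x - w\<close> not invertible.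
  Self-adjoint elements have real spectrum, so choosing \<open>x\<close> and \<open>w\<close> suitably restricts \<open>c\<close> to a
  real line or its image under a Moebius map. Applied to \<open>a + \<i>e\<close> and \<open>a + u + \<i>e\<close> this yields
  \<open>\<phi> (a + u) = \<phi> a + u\<close>, and applied to \<open>a + \<i>e\<close> and \<open>a\<^sup>2 + e\<^sup>2\<close> it yields
  \<open>\<phi> (a\<^sup>2) = (\<phi> a)\<^sup>2\<close> (both as \<open>e \<rightarrow> 0\<close>, for self-adjoint \<open>a\<close>). If \<open>h\<close> is self-adjoint and close
  to \<open>1\<close>, then \<open>h\<^sup>-\<^sup>1 d\<close> has real spectrum for self-adjoint \<open>d\<close>, whence
  \<open>Re (\<phi> (h + \<i>d)) = \<phi> h\<close>. Since \<open>\<phi>\<close> is complex homogeneous on invertible elements, rotating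
  \<open>h + \<i>d\<close> in the complex plane turns this into additivity of \<open>\<phi>\<close> on self-adjoint elements. So
  \<open>psi \<phi>\<close> is linear and preserves squares, hence multiplicative.
\<close>

section \<open>Complex scaling, invertibility and the Neumann series\<close>

lemma scaleC_zero_right [simp]: "c *\<^sub>C (0::'a::complex_banach_algebra_1) = 0"
  using norm_scaleC[of c "0::'a"] by simp

lemma scaleC_zero_left [simp]: "0 *\<^sub>C (x::'a::complex_banach_algebra_1) = 0"
  using scaleC_of_real[of 0 x] by simp

lemma scaleC_minus_right: "c *\<^sub>C (- x) = - (c *\<^sub>C (x::'a::complex_banach_algebra_1))"
  using scaleC_add_right[of c x "- x"] by (simp add: eq_neg_iff_add_eq_0 add.commute)

lemma scaleC_diff_right: "c *\<^sub>C (x - y) = c *\<^sub>C x - c *\<^sub>C (y::'a::complex_banach_algebra_1)"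
  using scaleC_add_right[of c x "- y"] by (simp add: scaleC_minus_right)

lemma scaleC_minus_left: "(- c) *\<^sub>C x = - (c *\<^sub>C (x::'a::complex_banach_algebra_1))"
  using scaleC_add_left[of c "- c" x] by (simp add: eq_neg_iff_add_eq_0 add.commute)

lemma scaleC_diff_left: "(c - d) *\<^sub>C x = c *\<^sub>C x - d *\<^sub>C (x::'a::complex_banach_algebra_1)"
  using scaleC_add_left[of c "- d" x] by (simp add: scaleC_minus_left)

lemma scaleR_conv_scaleC: "r *\<^sub>R x = of_real r *\<^sub>C (x::'a::complex_banach_algebra_1)"
  by (simp add: scaleC_of_real)

lemmas scaleC_simps = scaleC_add_right scaleC_add_left scaleC_diff_right scaleC_diff_left
  scaleC_minus_right scaleC_minus_left scaleC_scaleC scaleC_one mult_scaleC_left mult_scaleC_right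

definition invertible :: "'a::complex_banach_algebra_1 \<Rightarrow> bool"
  where "invertible x \<longleftrightarrow> (\<exists>y. y * x = 1 \<and> x * y = 1)"

lemma spectrum_iff: "c \<in> spectrum x \<longleftrightarrow> \<not> invertible (c *\<^sub>C 1 - x)"
  by (simp add: spectrum_def invertible_def)

lemma invertibleI: "y * x = 1 \<Longrightarrow> x * y = 1 \<Longrightarrow> invertible x"
  by (auto simp: invertible_def)

lemma invertible_mult:
  assumes "invertible x" "invertible y"
  shows "invertible (x * y)"
proof -
  obtain x' y' where "x' * x = 1" "x * x' = 1" "y' * y = 1" "y * y' = 1"
    using assms by (auto simp: invertible_def)
  then have "(y' * x') * (x * y) = 1" "(x * y) * (y' * x') = 1"
    by (metis mult.assoc mult.left_neutral)+
  then show ?thesis by (rule invertibleI)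
qed

lemma invertible_scaleC_one: "c \<noteq> 0 \<Longrightarrow> invertible (c *\<^sub>C 1)"
  by (rule invertibleI[where y = "inverse c *\<^sub>C 1"]) (simp_all add: scaleC_simps)

lemma invertible_scaleC:
  assumes "c \<noteq> 0" "invertible x"
  shows "invertible (c *\<^sub>C x)"
  using invertible_mult[OF invertible_scaleC_one[OF assms(1)] assms(2)]
  by (simp add: scaleC_simps)

lemma invertible_minus:
  assumes "invertible x" shows "invertible (- x)"
  using invertible_scaleC[of "- 1", OF _ assms] by (simp add: scaleC_simps)

lemma invertible_one_minus:
  fixes x :: "'a::complex_banach_algebra_1"
  assumes "norm x < 1"
  shows "invertible (1 - x)"
proof -
  have "summable (\<lambda>n. norm x ^ n)"
    using assms by (simp add: summable_geometric)
  then have "summable (\<lambda>n. norm (x ^ n))"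
    by (rule summable_comparison_test'[where N = 0]) (simp add: norm_power_ineq)
  then have s: "summable (\<lambda>n. x ^ n)" by (rule summable_norm_cancel)
  let ?S = "\<Sum>n. x ^ n"
  have l: "x * ?S = (\<Sum>n. x ^ Suc n)" by (simp add: suminf_mult[OF s])
  have r: "?S * x = (\<Sum>n. x ^ Suc n)"
    by (simp add: suminf_mult2[OF s] power_commutes)
  have "?S = 1 + (\<Sum>n. x ^ Suc n)"
    using suminf_split_initial_segment[OF s, of 1] by simp
  then have "?S * (1 - x) = 1" "(1 - x) * ?S = 1"
    using l r by (simp_all add: algebra_simps)
  then show ?thesis by (rule invertibleI)
qed

lemma spectrum_le_norm:
  assumes "c \<in> spectrum x"
  shows "cmod c \<le> norm x"
proof (rule ccontr)
  assume "\<not> ?thesis"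
  then have lt: "norm x < cmod c" by simp
  then have c: "c \<noteq> 0" by auto
  have "norm (inverse c *\<^sub>C x) < 1"
    using lt c by (simp add: norm_scaleC norm_inverse flip: divide_inverse_commute)
  then have "invertible (c *\<^sub>C (1 - inverse c *\<^sub>C x))"
    by (intro invertible_scaleC c invertible_one_minus)
  with assms c show False by (simp add: spectrum_iff scaleC_simps)
qed

section \<open>Involution and spectra of self-adjoint elements\<close>

lemma star_one [simp]: "star (1::'a::cstar_algebra_1) = 1"
  by (metis mult.left_neutral mult.right_neutral star_mult star_star)

lemma star_minus: "star (- x) = - star (x::'a::cstar_algebra_1)"
  using star_scaleC[of "- 1" x] by (simp add: scaleC_simps)

lemma star_diff: "star (x - y) = star x - star (y::'a::cstar_algebra_1)"
  using star_add[of x "- y"] by (simp add: star_minus)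

lemma star_scaleR: "star (r *\<^sub>R x) = r *\<^sub>R star (x::'a::cstar_algebra_1)"
  by (simp add: scaleR_conv_scaleC star_scaleC)

lemmas star_simps = star_star star_add star_diff star_minus star_scaleC star_scaleR star_mult

text \<open>Arens' trick: if \<open>c \<in> spectrum a\<close> then \<open>c + \<i>t \<in> spectrum (a + \<i>t)\<close>, so that
  \<open>(Im c + t)\<^sup>2 \<le> \<parallel>a + \<i>t\<parallel>\<^sup>2 = \<parallel>a\<^sup>2 + t\<^sup>2\<parallel> \<le> \<parallel>a\<parallel>\<^sup>2 + t\<^sup>2\<close> for all real \<open>t\<close>.\<close>

lemma spectrum_selfadjoint_real:
  fixes a :: "'a::cstar_algebra_1"
  assumes a: "star a = a" and c: "c \<in> spectrum a"
  shows "Im c = 0"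
proof (rule ccontr)
  assume nz: "Im c \<noteq> 0"
  have bound: "(Im c + t)\<^sup>2 \<le> (norm a)\<^sup>2 + t\<^sup>2" for t :: real
  proof -
    define x where "x = a + (\<i> * of_real t) *\<^sub>C 1"
    have "c + \<i> * of_real t \<in> spectrum x"
      using c by (simp add: spectrum_iff x_def scaleC_simps)
    then have "cmod (c + \<i> * of_real t) \<le> norm x" by (rule spectrum_le_norm)
    moreover have "\<bar>Im c + t\<bar> \<le> cmod (c + \<i> * of_real t)"
      using abs_Im_le_cmod[of "c + \<i> * of_real t"] by simp
    ultimately have "\<bar>Im c + t\<bar> \<le> norm x" by linarith
    then have "(Im c + t)\<^sup>2 \<le> (norm x)\<^sup>2"
      by (metis abs_ge_zero power2_abs power_mono)
    also have "\<dots> = norm (star x * x)" by (simp add: cstar_identity)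
    also have "star x * x = a * a + (t * t) *\<^sub>R 1"
      by (simp add: x_def star_simps a scaleC_simps scaleR_conv_scaleC algebra_simps)
    also have "norm \<dots> \<le> norm a * norm a + t * t"
      by (rule order_trans[OF norm_triangle_ineq add_mono[OF norm_mult_ineq]]) simp
    finally show ?thesis by (simp add: power2_eq_square)
  qed
  \<comment> \<open>This makes the cross term \<open>2 * t * Im c\<close> twice the squared norm of
    \<open>a\<close>, too large for \<open>bound\<close>.\<close>
  define t where "t = ((norm a)\<^sup>2) / Im c"
  have "t * Im c = (norm a)\<^sup>2" using nz by (simp add: t_def)
  then have "(Im c)\<^sup>2 + (norm a)\<^sup>2 \<le> 0"
    using bound[of t] by (simp add: power2_eq_square algebra_simps)
  moreover have "(Im c)\<^sup>2 > 0" using nz by simp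
  ultimately show False by (smt (verit) zero_le_power2)
qed

lemma invertible_selfadjoint_add:
  fixes a :: "'a::cstar_algebra_1"
  assumes "star a = a" "Im d \<noteq> 0"
  shows "invertible (a + d *\<^sub>C 1)"
proof -
  have "- d \<notin> spectrum a" using spectrum_selfadjoint_real[OF assms(1), of "- d"] assms(2) by auto
  then have "invertible (- ((- d) *\<^sub>C 1 - a))"
    by (intro invertible_minus) (simp add: spectrum_iff)
  then show ?thesis by (simp add: scaleC_simps algebra_simps)
qed

text \<open>The Cayley transform \<open>u = (y - \<i>) (y + \<i>)\<^sup>-\<^sup>1\<close> is unitary and
  \<open>1 - u = 2 \<i> (y + \<i>)\<^sup>-\<^sup>1\<close>.\<close>

lemma norm_inverse_selfadjoint_add_i:
  fixes y :: "'a::cstar_algebra_1"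
  assumes y: "star y = y" and z: "z * (y + \<i> *\<^sub>C 1) = 1" "(y + \<i> *\<^sub>C 1) * z = 1"
  shows "norm z \<le> 1"
proof -
  define u where "u = (y - \<i> *\<^sub>C 1) * z"
  \<comment> \<open>Applying \<open>star\<close> to the right inverse identity yields a left inverse
    of \<open>y - \<i>\<close>; commuting the two factors then gives
    \<open>star u * u = 1\<close>.\<close>
  have "star ((y + \<i> *\<^sub>C 1) * z) = 1" by (simp only: z star_one)
  then have z': "star z * (y - \<i> *\<^sub>C 1) = 1"
    by (simp add: star_simps y scaleC_simps)
  have comm: "(y + \<i> *\<^sub>C 1) * (y - \<i> *\<^sub>C 1) = (y - \<i> *\<^sub>C 1) * (y + \<i> *\<^sub>C 1)"
    by (simp add: algebra_simps scaleC_simps)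
  have "star u * u = star z * ((y + \<i> *\<^sub>C 1) * (y - \<i> *\<^sub>C 1)) * z"
    by (simp add: u_def star_simps y scaleC_simps mult.assoc)
  also have "\<dots> = (star z * (y - \<i> *\<^sub>C 1)) * ((y + \<i> *\<^sub>C 1) * z)"
    by (simp only: comm mult.assoc)
  also have "\<dots> = 1" by (simp only: z z' mult_1_left)
  finally have "(norm u)\<^sup>2 = 1" using cstar_identity[of u] by simp
  then have u: "norm u = 1" by (simp add: power2_eq_1_iff) (smt (verit) norm_ge_zero)
  have "1 - u = (y + \<i> *\<^sub>C 1) * z - (y - \<i> *\<^sub>C 1) * z" by (simp only: u_def z)
  also have "\<dots> = (2 * \<i>) *\<^sub>C z"
    by (simp add: algebra_simps scaleC_simps flip: scaleC_add_left)
  finally have "2 * norm z = norm (1 - u)" by (simp add: norm_scaleC norm_mult)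
  also have "\<dots> \<le> 2" using norm_triangle_ineq4[of 1 u] u by simp
  finally show ?thesis by simp
qed

text \<open>With \<open>z\<close> the inverse of \<open>y + \<i>\<close>, the element factors as
  \<open>y + \<i>\<close> times \<open>1 + \<i> z a\<close>; since \<open>z\<close> has norm at most
  1, the Neumann series inverts the second factor.\<close>

lemma invertible_selfadjoint_add_i_near_one:
  fixes y a :: "'a::cstar_algebra_1"
  assumes y: "star y = y" and a: "norm a < 1"
  shows "invertible (y + \<i> *\<^sub>C (1 + a))"
proof -
  have inv: "invertible (y + \<i> *\<^sub>C 1)" by (rule invertible_selfadjoint_add[OF y]) simp
  then obtain z where z: "z * (y + \<i> *\<^sub>C 1) = 1" "(y + \<i> *\<^sub>C 1) * z = 1"
    by (auto simp: invertible_def)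
  have "norm (- (z * \<i> *\<^sub>C a)) \<le> norm z * norm a"
    using norm_mult_ineq[of z "\<i> *\<^sub>C a"] by (simp add: norm_scaleC)
  also have "\<dots> \<le> norm a"
    using norm_inverse_selfadjoint_add_i[OF y z] by (simp add: mult_left_le_one_le)
  finally have "invertible (1 - (- (z * \<i> *\<^sub>C a)))"
    using a by (intro invertible_one_minus) simp
  then have "invertible ((y + \<i> *\<^sub>C 1) * (1 - (- (z * \<i> *\<^sub>C a))))"
    by (rule invertible_mult[OF inv])
  also have "(y + \<i> *\<^sub>C 1) * (1 - (- (z * \<i> *\<^sub>C a)))
      = (y + \<i> *\<^sub>C 1) + ((y + \<i> *\<^sub>C 1) * z) * \<i> *\<^sub>C a"
    by (simp add: distrib_left mult.assoc)
  also have "\<dots> = y + \<i> *\<^sub>C (1 + a)" by (simp only: z mult_1_left) (simp add: scaleC_simps)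
  finally show ?thesis .
qed

section \<open>From squares to products\<close>

text \<open>A linear functional preserving squares is multiplicative: if \<open>\<chi> x = 0\<close>, then
  \<open>(xy - yx)\<^sup>2 + (xy + yx)\<^sup>2 = 2 (x(yxy) + (yxy)x)\<close> forces \<open>\<chi> (xy - yx) = 0\<close>.\<close>

lemma multiplicative_if_preserves_squares:
  fixes \<chi> :: "'a::ring_1 \<Rightarrow> 'b::{idom, ring_char_0}"
  assumes add: "\<And>x y. \<chi> (x + y) = \<chi> x + \<chi> y"
    and sq: "\<And>x. \<chi> (x * x) = \<chi> x * \<chi> x"
    and split: "\<And>x. \<exists>k. \<chi> k = \<chi> x \<and> (\<forall>y. \<chi> (k * y) = \<chi> k * \<chi> y)"
  shows "\<chi> (x * y) = \<chi> x * \<chi> y"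
proof -
  have zero: "\<chi> 0 = 0" using add[of 0 0] by simp
  have minus: "\<chi> (- x) = - \<chi> x" for x
    using add[of x "- x"] by (simp add: zero eq_neg_iff_add_eq_0 add.commute)
  have diff: "\<chi> (x - y) = \<chi> x - \<chi> y" for x y using add[of x "- y"] by (simp add: minus)
  have jordan: "\<chi> (x * y + y * x) = 2 * \<chi> x * \<chi> y" for x y
    using sq[of "x + y"] by (simp add: add sq algebra_simps)
  have kernel: "\<chi> (x * y) = 0" if x: "\<chi> x = 0" for x y
  proof -
    define d s w where "d = x * y - y * x" and "s = x * y + y * x" and "w = y * x * y"
    have "d * d + s * s = (x * w + w * x) + (x * w + w * x)"
      by (simp add: d_def s_def w_def algebra_simps)
    then have "\<chi> (d * d) + \<chi> (s * s) = \<chi> (x * w + w * x) + \<chi> (x * w + w * x)"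
      by (metis add)
    then have "\<chi> d * \<chi> d + \<chi> s * \<chi> s = 0" by (simp add: sq jordan x)
    moreover have s: "\<chi> s = 0" by (simp add: s_def jordan x)
    ultimately have "\<chi> d = 0" by simp
    then have "\<chi> (x * y) = \<chi> (y * x)" by (simp add: d_def diff)
    then show ?thesis using s by (simp add: s_def add)
  qed
  \<comment> \<open>Subtracting \<open>k\<close>, on which multiplicativity is known, moves
    \<open>x\<close> into the kernel.\<close>
  obtain k where k: "\<chi> k = \<chi> x" "\<And>y. \<chi> (k * y) = \<chi> k * \<chi> y" using split by blast
  have "\<chi> ((x - k) * y) = 0" by (rule kernel) (simp add: diff k)
  then show ?thesis by (simp add: left_diff_distrib diff k)
qed

section \<open>Ratios, homogeneity and real shifts\<close>

locale spectral_product_function =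
  fixes \<phi> :: "'a::cstar_algebra_1 \<Rightarrow> complex"
  assumes product_spectrum: "\<And>x y. \<phi> x * \<phi> y \<in> spectrum (x * y)"
    and one: "\<phi> 1 = 1"
    and continuous: "continuous_on UNIV \<phi>"
begin

lemma in_spectrum: "\<phi> x \<in> spectrum x"
  using product_spectrum[of x 1] by (simp add: one)

text \<open>For the inverse \<open>z\<close> of \<open>x\<close>, the spectrum of
  \<open>z * x = 1\<close> is \<open>{1}\<close>, so \<open>\<phi> z\<close> inverts
  \<open>\<phi> x\<close>. Take \<open>c = \<phi> z * \<phi> w\<close>, which lies in the spectrum
  of \<open>z * w\<close>. Apart from \<open>in_spectrum\<close>, the product hypothesis enters only
  here.\<close>

lemma ratio:
  assumes "invertible x"
  obtains c where "\<phi> w = \<phi> x * c" "\<not> invertible (c *\<^sub>C x - w)"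
proof -
  obtain z where z: "z * x = 1" "x * z = 1" using assms by (auto simp: invertible_def)
  have "\<not> invertible ((\<phi> z * \<phi> x) *\<^sub>C 1 - (1::'a))"
    using product_spectrum[of z x] by (simp add: z spectrum_iff)
  then have "\<phi> z * \<phi> x - 1 = 0"
    using invertible_scaleC_one[of "\<phi> z * \<phi> x - 1"] by (auto simp: scaleC_simps)
  then have zx: "\<phi> x * \<phi> z = 1" by (simp add: mult.commute)
  define c where "c = \<phi> z * \<phi> w"
  have "\<phi> w = \<phi> x * c" using zx by (simp add: c_def flip: mult.assoc)
  moreover have "\<not> invertible (c *\<^sub>C x - w)"
  proof
    assume "invertible (c *\<^sub>C x - w)"
    moreover have "invertible z" using z by (rule invertibleI[rotated])
    ultimately have "invertible (z * (c *\<^sub>C x - w))" by (intro invertible_mult)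
    then have "invertible (c *\<^sub>C 1 - z * w)" by (simp add: scaleC_simps right_diff_distrib z)
    then show False using product_spectrum[of z w] by (simp add: spectrum_iff c_def)
  qed
  ultimately show thesis by (rule that)
qed

lemma scaleC_invertible:
  assumes "invertible x"
  shows "\<phi> (k *\<^sub>C x) = k * \<phi> x"
proof -
  obtain c where c: "\<phi> (k *\<^sub>C x) = \<phi> x * c" "\<not> invertible (c *\<^sub>C x - k *\<^sub>C x)"
    using ratio[OF assms] by blast
  then have "c - k = 0"
    using invertible_scaleC[of "c - k", OF _ assms] by (auto simp: scaleC_simps)
  then show ?thesis using c by simp
qed

lemma selfadjoint_real: "star a = a \<Longrightarrow> Im (\<phi> a) = 0"
  using spectrum_selfadjoint_real in_spectrum by blast

lemma Im_selfadjoint_add: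
  assumes "star a = a"
  shows "Im (\<phi> (a + d *\<^sub>C 1)) = Im d"
proof -
  have "\<phi> (a + d *\<^sub>C 1) - d \<in> spectrum a"
    using in_spectrum[of "a + d *\<^sub>C 1"] by (simp add: spectrum_iff scaleC_simps algebra_simps)
  then show ?thesis using spectrum_selfadjoint_real[OF assms] by force
qed

text \<open>Continuity enters here: values at a possibly singular \<open>a\<close> become limits of
  values at nearby elements.\<close>

lemma tendsto_line: "((\<lambda>e. \<phi> (a + e *\<^sub>R b)) \<longlongrightarrow> \<phi> a) (at 0)"
proof -
  have "((\<lambda>e. a + e *\<^sub>R b) \<longlongrightarrow> a + 0 *\<^sub>R b) (at (0::real))" by (intro tendsto_intros)
  then have "((\<lambda>e. a + e *\<^sub>R b) \<longlongrightarrow> a) (at (0::real))" by simp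
  moreover have "isCont \<phi> a" using continuous by (simp add: continuous_on_eq_continuous_at)
  ultimately show ?thesis by (rule isCont_tendsto_compose[rotated])
qed

lemma invertible_line:
  assumes "star a = a" "e \<noteq> 0"
  shows "invertible (a + e *\<^sub>R \<i> *\<^sub>C 1)"
  using invertible_selfadjoint_add[of a "of_real e * \<i>"] assms
  by (simp add: scaleR_conv_scaleC scaleC_simps)

lemma Im_line:
  assumes "star a = a"
  shows "Im (\<phi> (a + e *\<^sub>R \<i> *\<^sub>C 1)) = e"
  using Im_selfadjoint_add[of a "of_real e * \<i>"] assms
  by (simp add: scaleR_conv_scaleC scaleC_simps)

lemma selfadjoint_scaleR:
  assumes a: "star a = a"
  shows "\<phi> (t *\<^sub>R a) = t * \<phi> a"
proof -
  \<comment> \<open>The direction \<open>t *\<^sub>R \<i> *\<^sub>C 1\<close> makes the argument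
    exactly \<open>t\<close> times the invertible \<open>a + \<i>e\<close>.\<close>
  have "((\<lambda>e. \<phi> (t *\<^sub>R a + e *\<^sub>R t *\<^sub>R \<i> *\<^sub>C 1)) \<longlongrightarrow> \<phi> (t *\<^sub>R a)) (at 0)"
    by (rule tendsto_line)
  moreover have "\<forall>\<^sub>F e in at (0::real). \<phi> (t *\<^sub>R a + e *\<^sub>R t *\<^sub>R \<i> *\<^sub>C 1) = t * \<phi> (a + e *\<^sub>R \<i> *\<^sub>C 1)"
    unfolding eventually_at
  proof (intro exI[of _ 1] conjI ballI impI)
    fix e :: real assume "e \<noteq> 0 \<and> dist e 0 < 1"
    then have "invertible (a + e *\<^sub>R \<i> *\<^sub>C 1)" using a by (intro invertible_line) auto
    from scaleC_invertible[OF this, of "of_real t"]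
    show "\<phi> (t *\<^sub>R a + e *\<^sub>R t *\<^sub>R \<i> *\<^sub>C 1) = t * \<phi> (a + e *\<^sub>R \<i> *\<^sub>C 1)"
      by (simp add: scaleC_of_real scaleR_add_right mult.commute)
  qed simp
  ultimately have "((\<lambda>e. t * \<phi> (a + e *\<^sub>R \<i> *\<^sub>C 1)) \<longlongrightarrow> \<phi> (t *\<^sub>R a)) (at 0)"
    by (rule Lim_transform_eventually)
  moreover have "((\<lambda>e. t * \<phi> (a + e *\<^sub>R \<i> *\<^sub>C 1)) \<longlongrightarrow> t * \<phi> a) (at 0)"
    by (intro tendsto_mult_left tendsto_line)
  ultimately show ?thesis using tendsto_unique[OF at_neq_bot] by blast
qed

text \<open>The ratio of the values at \<open>a + u + \<i>e\<close> and \<open>a + \<i>e\<close> has the form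
  \<open>(r + u + \<i>e) / (r + \<i>e)\<close> with \<open>r\<close> real; both values have imaginary part \<open>e\<close>, and
  comparing imaginary parts after clearing denominators determines their difference.\<close>

lemma add_real_line:
  assumes a: "star a = a" and e: "e \<noteq> 0"
  shows "\<phi> ((a + u *\<^sub>R 1) + e *\<^sub>R \<i> *\<^sub>C 1) = \<phi> (a + e *\<^sub>R \<i> *\<^sub>C 1) + u"
proof (cases "u = 0")
  case False
  define x where "x = a + e *\<^sub>R \<i> *\<^sub>C 1"
  define w where "w = (a + u *\<^sub>R 1) + e *\<^sub>R \<i> *\<^sub>C 1"
  obtain c where c: "\<phi> w = \<phi> x * c" "\<not> invertible (c *\<^sub>C x - w)"
    using ratio[OF invertible_line[OF a e]] unfolding x_def by blast
  have cxw: "c *\<^sub>C x - w = (c - 1) *\<^sub>C x - of_real u *\<^sub>C 1"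
    by (simp add: x_def w_def scaleC_simps scaleR_conv_scaleC algebra_simps)
  have c1: "c \<noteq> 1"
    using c(2) invertible_minus[OF invertible_scaleC_one[of "of_real u"]] False
    by (auto simp: cxw)
  \<comment> \<open>Chosen so that \<open>c x - w = (c - 1) (x - d)\<close>; singularity of
    \<open>x - d\<close> forces \<open>Im d = e\<close>, and \<open>r\<close> is
    \<open>Re d\<close>.\<close>
  define d where "d = of_real u / (c - 1)"
  have "(c - 1) *\<^sub>C (a + (e * \<i> - d) *\<^sub>C 1) = c *\<^sub>C x - w"
  proof -
    have "(c - 1) * d = of_real u" using c1 by (simp add: d_def)
    then have "(c - 1) *\<^sub>C d *\<^sub>C (1::'a) = of_real u *\<^sub>C 1" by (simp add: scaleC_scaleC)
    moreover have "a + (e * \<i> - d) *\<^sub>C 1 = x - d *\<^sub>C 1"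
      by (simp add: x_def scaleC_simps scaleR_conv_scaleC)
    ultimately show ?thesis by (simp only: cxw scaleC_diff_right)
  qed
  then have "\<not> invertible (a + (e * \<i> - d) *\<^sub>C 1)"
    using c(2) c1 invertible_scaleC[of "c - 1"] by (metis right_minus_eq)
  then have d: "Im d = e" using invertible_selfadjoint_add[OF a, of "e * \<i> - d"] by auto
  have "d \<noteq> 0" using d e by auto
  have cd: "c * d = d + u" using c1 by (simp add: d_def field_simps)
  have eq: "\<phi> w * d = \<phi> x * (d + u)" by (simp add: c(1) cd mult.assoc)
  have ix: "Im (\<phi> x) = e" using Im_line[OF a] by (simp add: x_def)
  have iw: "Im (\<phi> w) = e"
    unfolding w_def by (rule Im_line) (simp add: star_simps a)
  have "e * (Re (\<phi> w) - Re (\<phi> x) - u) = 0"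
    using arg_cong[OF eq, of Im] by (simp add: ix iw d algebra_simps)
  then have "Re (\<phi> w) = Re (\<phi> x) + u" using e by simp
  then show ?thesis using ix iw by (simp add: x_def w_def complex_eq_iff)
qed simp

lemma selfadjoint_add_real:
  assumes a: "star a = a"
  shows "\<phi> (a + u *\<^sub>R 1) = \<phi> a + u"
proof -
  have "\<forall>\<^sub>F e in at (0::real).
      \<phi> ((a + u *\<^sub>R 1) + e *\<^sub>R \<i> *\<^sub>C 1) = \<phi> (a + e *\<^sub>R \<i> *\<^sub>C 1) + u"
    using add_real_line[OF a] by (auto simp: eventually_at intro!: exI[of _ 1])
  then have "((\<lambda>e. \<phi> (a + e *\<^sub>R \<i> *\<^sub>C 1) + u) \<longlongrightarrow> \<phi> (a + u *\<^sub>R 1)) (at 0)"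
    by (rule Lim_transform_eventually[OF tendsto_line])
  moreover have "((\<lambda>e. \<phi> (a + e *\<^sub>R \<i> *\<^sub>C 1) + u) \<longlongrightarrow> \<phi> a + u) (at 0)"
    by (intro tendsto_add tendsto_line tendsto_const)
  ultimately show ?thesis using tendsto_unique[OF at_neq_bot] by blast
qed

section \<open>Additivity on self-adjoint elements\<close>

text \<open>Put \<open>h = 1 + a\<close> and let \<open>k = 1 + \<i> m\<close> be the ratio of the
  values. Then \<open>\<i> (m h - d)\<close> is singular, which forces \<open>m\<close> to be real;
  \<open>\<phi> h\<close> is real too.\<close>

lemma Re_near_one:
  assumes a: "star a = a" "norm a < 1" and d: "star d = d"
  shows "Re (\<phi> (1 + a + \<i> *\<^sub>C d)) = Re (\<phi> (1 + a))"
proof -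
  have "invertible (1 + a)" using invertible_one_minus[of "- a"] a by simp
  then obtain k where k: "\<phi> (1 + a + \<i> *\<^sub>C d) = \<phi> (1 + a) * k"
    "\<not> invertible (k *\<^sub>C (1 + a) - (1 + a + \<i> *\<^sub>C d))"
    by (rule ratio)
  define m where "m = - \<i> * (k - 1)"
  have km: "k = 1 + \<i> * m" by (simp add: m_def)
  have "Im m = 0"
  proof (rule ccontr)
    assume nz: "Im m \<noteq> 0"
    \<comment> \<open>Dividing \<open>m (1 + a) - d\<close> by \<open>Im m\<close> gives
      \<open>y + \<i> (1 + a)\<close>.\<close>
    define y where "y = (Re m / Im m) *\<^sub>R (1 + a) - (1 / Im m) *\<^sub>R d"
    have "star y = y" by (simp add: y_def star_simps a d)
    then have "invertible ((\<i> * Im m) *\<^sub>C (y + \<i> *\<^sub>C (1 + a)))"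
      using nz by (intro invertible_scaleC invertible_selfadjoint_add_i_near_one a) auto
    also have "(\<i> * Im m) *\<^sub>C (y + \<i> *\<^sub>C (1 + a))
        = (\<i> * (Re m + \<i> * Im m)) *\<^sub>C (1 + a) - \<i> *\<^sub>C d"
      using nz unfolding y_def by (simp add: scaleC_simps scaleR_conv_scaleC algebra_simps)
    also have "\<dots> = k *\<^sub>C (1 + a) - (1 + a + \<i> *\<^sub>C d)"
      unfolding km complex_eq[of m, symmetric] by (simp add: scaleC_simps algebra_simps)
    finally show False using k(2) by simp
  qed
  moreover have "Im (\<phi> (1 + a)) = 0" by (intro selfadjoint_real) (simp add: star_simps a)
  ultimately show ?thesis by (simp add: k(1) km)
qed

text \<open>With \<open>c = 1 + a\<close>, \<open>d = 1 + b\<close> and \<open>x = c + \<i>d\<close>, the previous lemma applies to \<open>x\<close>,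
  to \<open>- \<i>x\<close> and to \<open>(1 - \<i>)x / 2\<close>, whose real parts are \<open>c\<close>, \<open>d\<close> and \<open>(c + d) / 2\<close>.\<close>

lemma midpoint_near_zero:
  assumes a: "star a = a" "norm a < 1" and b: "star b = b" "norm b < 1"
  shows "2 * \<phi> ((1 / 2) *\<^sub>R (a + b)) = \<phi> a + \<phi> b"
proof -
  define x where "x = 1 + a + \<i> *\<^sub>C (1 + b)"
  have inv: "invertible x"
    unfolding x_def by (rule invertible_selfadjoint_add_i_near_one) (simp_all add: star_simps a b)
  have shift: "Re (\<phi> (1 + h)) = 1 + Re (\<phi> h)" if "star h = h" for h
    using selfadjoint_add_real[OF that, of 1] by (simp add: add.commute)
  have r: "Re (\<phi> x) = 1 + Re (\<phi> a)"
    unfolding x_def by (simp add: Re_near_one a b star_simps shift)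
  have "(- \<i>) *\<^sub>C x = 1 + b + \<i> *\<^sub>C (- (1 + a))"
    by (simp add: x_def scaleC_simps algebra_simps)
  moreover have "Re (\<phi> (1 + b + \<i> *\<^sub>C (- (1 + a)))) = 1 + Re (\<phi> b)"
    by (subst Re_near_one) (simp_all add: a b star_simps shift)
  ultimately have i: "Im (\<phi> x) = 1 + Re (\<phi> b)"
    using scaleC_invertible[OF inv, of "- \<i>"] by simp
  define h where "h = (1 / 2) *\<^sub>R (a + b)"
  have h: "star h = h" by (simp add: h_def star_simps a b)
  have "norm (a + b) < 2" using norm_triangle_ineq[of a b] a b by simp
  then have nh: "norm h < 1" by (simp add: h_def)
  have "((1 - \<i>) / 2) *\<^sub>C x = ((1 - \<i>) / 2) *\<^sub>C (1 + a) + ((1 + \<i>) / 2) *\<^sub>C (1 + b)"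
    by (simp add: x_def scaleC_simps algebra_simps diff_divide_distrib add_divide_distrib)
  also have "\<dots> = (1 / 2) *\<^sub>C ((1 + a) + (1 + b)) + (\<i> / 2) *\<^sub>C (b - a)"
    by (simp add: scaleC_simps algebra_simps diff_divide_distrib add_divide_distrib)
  also have "(1 / 2) *\<^sub>C ((1 + a) + (1 + b)) = (1 / 2) *\<^sub>C 1 + (1 / 2) *\<^sub>C 1 + (1 / 2) *\<^sub>C (a + b)"
    by (simp add: scaleC_simps algebra_simps)
  also have "\<dots> = 1 + h"
    by (simp add: h_def scaleR_conv_scaleC scaleC_one flip: scaleC_add_left)
  also have "(\<i> / 2) *\<^sub>C (b - a) = \<i> *\<^sub>C ((1 / 2) *\<^sub>R (b - a))"
    by (simp add: scaleR_conv_scaleC scaleC_scaleC)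
  finally have "((1 - \<i>) / 2) *\<^sub>C x = 1 + h + \<i> *\<^sub>C ((1 / 2) *\<^sub>R (b - a))" .
  moreover have "Re (\<phi> (1 + h + \<i> *\<^sub>C ((1 / 2) *\<^sub>R (b - a)))) = 1 + Re (\<phi> h)"
    by (subst Re_near_one) (simp_all add: a b h nh star_simps shift)
  \<comment> \<open>The factor \<open>(1 - \<i>) / 2\<close> averages the real and imaginary parts
    of \<open>\<phi> x\<close>.\<close>
  ultimately have "1 + Re (\<phi> h) = Re ((1 - \<i>) / 2 * \<phi> x)"
    using scaleC_invertible[OF inv, of "(1 - \<i>) / 2"] by (simp only:)
  also have "\<dots> = (Re (\<phi> x) + Im (\<phi> x)) / 2" by (simp add: field_simps)
  finally have "2 * Re (\<phi> h) = Re (\<phi> a) + Re (\<phi> b)" by (simp add: r i)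
  moreover have "Im (\<phi> h) = 0" "Im (\<phi> a) = 0" "Im (\<phi> b) = 0"
    using a b h by (simp_all add: selfadjoint_real)
  ultimately show ?thesis by (simp add: h_def[symmetric] complex_eq_iff)
qed

text \<open>Real homogeneity shrinks both elements into the unit ball and then cancels
  \<open>t\<close> and the factor one half.\<close>

lemma selfadjoint_add:
  assumes a: "star a = a" and b: "star b = b"
  shows "\<phi> (a + b) = \<phi> a + \<phi> b"
proof -
  define t where "t = 1 / (1 + norm a + norm b)"
  have n: "0 < 1 + norm a + norm b" by (smt (verit) norm_ge_zero)
  then have t: "t > 0" by (simp add: t_def)
  have small: "norm (t *\<^sub>R a) < 1" "norm (t *\<^sub>R b) < 1"
    using n by (simp_all add: t_def pos_divide_less_eq add_pos_nonneg)
  have "2 * \<phi> ((1 / 2) *\<^sub>R (t *\<^sub>R a + t *\<^sub>R b)) = \<phi> (t *\<^sub>R a) + \<phi> (t *\<^sub>R b)"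
    by (rule midpoint_near_zero[OF _ small(1) _ small(2)]) (simp_all add: star_simps a b)
  moreover have "(1 / 2) *\<^sub>R (t *\<^sub>R a + t *\<^sub>R b) = (t / 2) *\<^sub>R (a + b)"
    by (simp add: scaleR_add_right)
  moreover have "star (a + b) = a + b" by (simp add: star_simps a b)
  ultimately have "t * \<phi> (a + b) = t * (\<phi> a + \<phi> b)"
    by (simp add: selfadjoint_scaleR a b distrib_left)
  then show ?thesis using t by simp
qed

lemma selfadjoint_diff:
  assumes a: "star a = a" and b: "star b = b"
  shows "\<phi> (a - b) = \<phi> a - \<phi> b"
  using selfadjoint_add[OF a, of "(- 1) *\<^sub>R b"] selfadjoint_scaleR[OF b, of "- 1"] b
  by (simp add: star_simps)

section \<open>Squares of self-adjoint elements\<close>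

text \<open>The value at \<open>a\<^sup>2 + e\<^sup>2 = (a + \<i>e) (a - \<i>e)\<close> is real and of the form
  \<open>\<phi> (a + \<i>e) (r - \<i>e)\<close> with \<open>r\<close> real, which forces \<open>r = Re (\<phi> (a + \<i>e))\<close>.\<close>

lemma square_line:
  assumes a: "star a = a" and e: "e \<noteq> 0"
  shows "\<phi> (a * a) = (Re (\<phi> (a + e *\<^sub>R \<i> *\<^sub>C 1)))\<^sup>2"
proof -
  define x where "x = a + e *\<^sub>R \<i> *\<^sub>C 1"
  have inv: "invertible x" using invertible_line[OF a e] by (simp add: x_def)
  obtain c where c: "\<phi> (a * a + (e\<^sup>2) *\<^sub>R 1) = \<phi> x * c"
    "\<not> invertible (c *\<^sub>C x - (a * a + (e\<^sup>2) *\<^sub>R 1))"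
    using ratio[OF inv] by blast
  \<comment> \<open>Splitting off \<open>x\<close> on the left leaves a scalar shift of
    \<open>a\<close>, singular only if the shift is real.\<close>
  have "c *\<^sub>C x - (a * a + (e\<^sup>2) *\<^sub>R 1) = x * (- (a + (- \<i> * e - c) *\<^sub>C 1))"
    by (simp add: x_def scaleR_conv_scaleC scaleC_simps algebra_simps power2_eq_square)
  then have "\<not> invertible (a + (- \<i> * e - c) *\<^sub>C 1)"
    using c(2) inv by (metis invertible_mult invertible_minus)
  then have "- e - Im c = 0" using invertible_selfadjoint_add[OF a, of "- \<i> * e - c"] by auto
  then have ic: "Im c = - e" by simp
  have ix: "Im (\<phi> x) = e" using Im_line[OF a] by (simp add: x_def)
  have aa: "star (a * a) = a * a" by (simp add: star_simps a)
  have "\<phi> (a * a + (e\<^sup>2) *\<^sub>R 1) = \<phi> (a * a) + of_real (e\<^sup>2)"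
    by (rule selfadjoint_add_real[OF aa])
  with c have eq: "\<phi> (a * a) + of_real (e\<^sup>2) = \<phi> x * c" by simp
  have iaa: "Im (\<phi> (a * a)) = 0" by (rule selfadjoint_real[OF aa])
  have "e * (Re c - Re (\<phi> x)) = 0"
    using arg_cong[OF eq, of Im] by (auto simp: ix ic iaa algebra_simps simp flip: of_real_power)
  then have rc: "Re c = Re (\<phi> x)" using e by auto
  \<comment> \<open>The real part of \<open>\<phi> x * c\<close> is
    \<open>(Re (\<phi> x))\<^sup>2 + e\<^sup>2\<close>, so the shift by \<open>e\<^sup>2\<close>
    cancels exactly.\<close>
  have "Re (\<phi> (a * a)) = (Re (\<phi> x))\<^sup>2"
    using arg_cong[OF eq, of Re] by (simp add: ix ic rc power2_eq_square flip: of_real_power)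
  then show ?thesis using iaa by (simp add: x_def complex_eq_iff flip: of_real_power)
qed

lemma selfadjoint_square:
  assumes a: "star a = a"
  shows "\<phi> (a * a) = (\<phi> a)\<^sup>2"
proof -
  let ?f = "\<lambda>e::real. complex_of_real ((Re (\<phi> (a + e *\<^sub>R \<i> *\<^sub>C 1)))\<^sup>2)"
  have "(?f \<longlongrightarrow> of_real ((Re (\<phi> a))\<^sup>2)) (at 0)"
    by (intro tendsto_of_real tendsto_power tendsto_Re tendsto_line)
  moreover have "(?f \<longlongrightarrow> \<phi> (a * a)) (at 0)"
  proof (rule Lim_transform_eventually[OF tendsto_const])
    show "\<forall>\<^sub>F e in at 0. \<phi> (a * a) = ?f e"
      using square_line[OF a] by (auto simp: eventually_at intro!: exI[of _ 1])
  qed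
  ultimately have "\<phi> (a * a) = of_real ((Re (\<phi> a))\<^sup>2)"
    using tendsto_unique[OF at_neq_bot] by blast
  also have "of_real (Re (\<phi> a)) = \<phi> a" using selfadjoint_real[OF a] by (simp add: complex_eq_iff)
  then have "complex_of_real ((Re (\<phi> a))\<^sup>2) = (\<phi> a)\<^sup>2" by simp
  finally show ?thesis .
qed

text \<open>Polarization of squares; the symmetric sum is self-adjoint, while \<open>a * b\<close>
  may fail to be.\<close>

lemma selfadjoint_anticommutator:
  assumes a: "star a = a" and b: "star b = b"
  shows "\<phi> (a * b + b * a) = 2 * \<phi> a * \<phi> b"
proof -
  have s: "star (a + b) = a + b" "star (a * a) = a * a" "star (b * b) = b * b"
    "star (a * b + b * a) = a * b + b * a"
    by (simp_all add: star_add star_mult a b add.commute)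
  have "(a + b) * (a + b) = (a * a + b * b) + (a * b + b * a)" by (simp add: algebra_simps)
  moreover have "\<phi> ((a * a + b * b) + (a * b + b * a))
      = \<phi> (a * a) + \<phi> (b * b) + \<phi> (a * b + b * a)"
    by (subst selfadjoint_add) (simp_all add: star_add star_mult a b selfadjoint_add add.commute)
  ultimately show ?thesis
    using selfadjoint_square[OF a] selfadjoint_square[OF b] selfadjoint_square[OF s(1)]
    by (simp add: selfadjoint_add a b power2_eq_square algebra_simps)
qed

end

section \<open>Cartesian decomposition and the character\<close>

lemma star_re_part: "star (re_part x) = re_part x"
  by (simp add: re_part_def star_simps add.commute)

lemma star_im_part: "star (im_part x) = im_part x"
  by (simp add: im_part_def star_simps scaleC_simps)

lemma re_part_im_part: "x = re_part x + \<i> *\<^sub>C im_part x"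
  by (simp add: re_part_def im_part_def scaleC_simps flip: scaleC_add_left)

lemma re_part_selfadjoint: "star a = a \<Longrightarrow> star b = b \<Longrightarrow> re_part (a + \<i> *\<^sub>C b) = a"
  by (simp add: re_part_def star_simps scaleC_simps flip: scaleC_add_left)

lemma im_part_selfadjoint: "star a = a \<Longrightarrow> star b = b \<Longrightarrow> im_part (a + \<i> *\<^sub>C b) = b"
  by (simp add: im_part_def star_simps scaleC_simps flip: scaleC_add_left)

context spectral_product_function
begin

lemma psi_selfadjoint:
  assumes "star a = a" "star b = b"
  shows "psi \<phi> (a + \<i> *\<^sub>C b) = \<phi> a + \<i> * \<phi> b"
  by (simp add: psi_def re_part_selfadjoint im_part_selfadjoint assms)

lemma psi_add: "psi \<phi> (x + y) = psi \<phi> x + psi \<phi> y"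
proof -
  have "x + y = (re_part x + re_part y) + \<i> *\<^sub>C (im_part x + im_part y)"
    by (subst re_part_im_part[of x], subst re_part_im_part[of y]) (simp add: scaleC_simps)
  then have "psi \<phi> (x + y) = \<phi> (re_part x + re_part y) + \<i> * \<phi> (im_part x + im_part y)"
    using psi_selfadjoint[of "re_part x + re_part y" "im_part x + im_part y"]
    by (simp add: star_add star_re_part star_im_part)
  then show ?thesis
    by (simp add: psi_def selfadjoint_add star_re_part star_im_part algebra_simps)
qed

lemma psi_scaleC: "psi \<phi> (c *\<^sub>C x) = c * psi \<phi> x"
proof -
  let ?a = "re_part x" and ?b = "im_part x"
  let ?r = "Re c *\<^sub>R ?a - Im c *\<^sub>R ?b" and ?s = "Re c *\<^sub>R ?b + Im c *\<^sub>R ?a"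
  have "c *\<^sub>C x = (Re c + \<i> * Im c) *\<^sub>C (?a + \<i> *\<^sub>C ?b)"
    unfolding re_part_im_part[of x, symmetric] complex_eq[of c, symmetric] ..
  also have "\<dots> = ?r + \<i> *\<^sub>C ?s"
    by (simp add: scaleC_simps scaleR_conv_scaleC algebra_simps)
  finally have "psi \<phi> (c *\<^sub>C x) = \<phi> ?r + \<i> * \<phi> ?s"
    by (simp add: psi_selfadjoint star_simps star_re_part star_im_part)
  also have "\<dots> = (Re c + \<i> * Im c) * (\<phi> ?a + \<i> * \<phi> ?b)"
    by (simp add: selfadjoint_add selfadjoint_diff selfadjoint_scaleR star_simps
        star_re_part star_im_part algebra_simps)
  finally show ?thesis unfolding psi_def complex_eq[of c, symmetric] .
qed

lemma psi_square: "psi \<phi> (x * x) = psi \<phi> x * psi \<phi> x"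
proof -
  let ?a = "re_part x" and ?b = "im_part x"
  have sa: "star ?a = ?a" "star ?b = ?b" by (simp_all add: star_re_part star_im_part)
  have "x * x = (?a + \<i> *\<^sub>C ?b) * (?a + \<i> *\<^sub>C ?b)"
    unfolding re_part_im_part[of x, symmetric] ..
  \<comment> \<open>Both summands in brackets are self-adjoint, so these are the real and imaginary
    parts of \<open>x * x\<close>.\<close>
  also have "\<dots> = (?a * ?a - ?b * ?b) + \<i> *\<^sub>C (?a * ?b + ?b * ?a)"
    by (simp add: scaleC_simps algebra_simps)
  also have "psi \<phi> \<dots> = \<phi> (?a * ?a - ?b * ?b) + \<i> * \<phi> (?a * ?b + ?b * ?a)"
    by (rule psi_selfadjoint) (simp_all add: star_simps sa add.commute)
  also have "\<dots> = (\<phi> ?a)\<^sup>2 - (\<phi> ?b)\<^sup>2 + \<i> * (2 * \<phi> ?a * \<phi> ?b)"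
    by (simp add: selfadjoint_diff selfadjoint_anticommutator selfadjoint_square star_simps sa)
  also have "\<dots> = psi \<phi> x * psi \<phi> x" by (simp add: psi_def power2_eq_square algebra_simps)
  finally show ?thesis .
qed

lemma psi_one: "psi \<phi> 1 = 1"
  using psi_selfadjoint[of 1 0] selfadjoint_scaleR[of 1 0] by (simp add: one star_diff[of 1 1, simplified])

lemma psi_mult: "psi \<phi> (x * y) = psi \<phi> x * psi \<phi> y"
proof (rule multiplicative_if_preserves_squares)
  \<comment> \<open>The witness is a scalar multiple of the unit, where multiplicativity is just
    linearity.\<close>
  show "\<exists>k. psi \<phi> k = psi \<phi> x \<and> (\<forall>y. psi \<phi> (k * y) = psi \<phi> k * psi \<phi> y)" for x
    by (rule exI[of _ "psi \<phi> x *\<^sub>C 1"]) (simp add: psi_scaleC psi_one mult_scaleC_left)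
qed (simp_all add: psi_add psi_square)

lemma psi_character: "is_character (psi \<phi>)"
  unfolding is_character_def
proof (intro conjI allI psi_mult)
  interpret A: vector_space "scaleC :: complex \<Rightarrow> 'a \<Rightarrow> 'a" by (rule vector_space_scaleC)
  interpret C: vector_space "times :: complex \<Rightarrow> complex \<Rightarrow> complex"
    by unfold_locales (simp_all add: algebra_simps)
  show "Vector_Spaces.linear scaleC times (psi \<phi>)"
    by unfold_locales (simp_all add: psi_add psi_scaleC)
qed

end

theorem theorem3p7:
  fixes \<phi> :: "'a::cstar_algebra_1 \<Rightarrow> complex"
  assumes P1: "\<And>x y. \<phi> x * \<phi> y \<in> spectrum (x * y)"
    and P2: "\<phi> 1 = 1"
    and P3: "continuous_on UNIV \<phi>"
  shows "is_character (psi \<phi>)"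
proof -
  interpret spectral_product_function \<phi> by unfold_locales (fact P1 P2 P3)+
  show ?thesis by (rule psi_character)
qed

end
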